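(* Let $\mathcal{X}$ be a finite non-empty set, let $A\subset\mathcal{X}$, and let $\mathcal{T}$ be a non-empty, closed, convex set of transition matrices on $\mathcal{X}$ that has separately specified rows. Then there exists a $P\in\mathcal{P}_{\mathcal{T}}^{\mathrm{H}}$ such that, for all $x\in\mathcal{X}$, $$\underline{\mathbb{E}}_{\mathcal{T}}^{\mathrm{V}}[G_A\,|\,X_0=x]=\underline{\mathbb{E}}_{\mathcal{T}}^{\mathrm{I}}[G_A\,|\,X_0=x]=\underline{\mathbb{E}}_{\mathcal{T}}^{\mathrm{H}}[G_A\,|\,X_0=x]=\mathbb{E}_P[G_A\,|\,X_0=x].$$ Moreover, for all $x\in\mathcal{X}$, $$\overline{\mathbb{E}}_{\mathcal{T}}^{\mathrm{V}}[G_A\,|\,X_0=x]=\overline{\mathbb{E}}_{\mathcal{T}}^{\mathrm{I}}[G_A\,|\,X_0=x]=\overline{\mathbb{E}}_{\mathcal{T}}^{\mathrm{H}}[G_A\,|\,X_0=x].$$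
   Context: Conventions. $\mathbb{N}_0=\{0,1,2,\dots\}$; $0\cdot(+\infty)=0\cdot(-\infty)=0$. $\mathcal{L}^{+\infty}(\mathcal{X})$ is the set of functions $\mathcal{X}\to\mathbb{R}\cup\{+\infty\}$. Transition matrices. A transition matrix on $\mathcal{X}$ is a row-stochastic $|\mathcal{X}|\times|\mathcal{X}|$ matrix $T$; it acts on $f\in\mathcal{L}^{+\infty}(\mathcal{X})$ by $[Tf](x)=\sum_{y}T(x,y)f(y)$. A set $\mathcal{T}$ of transition matrices has separately specified rows if, for every choice of $T_x\in\mathcal{T}$ ($x\in\mathcal{X}$), there is a $T\in\mathcal{T}$ with $T(x,\cdot)=T_x(x,\cdot)$ for all $x\in\mathcal{X}$. Put $[\overline{T}f](x)=\sup_{T\in\mathcal{T}}[Tf](x)$ for $f\in\mathcal{L}^{+\infty}(\mathcal{X})$. Stochastic processes. $\Omega$ is the set of all paths $\omega:\mathbb{N}_0\to\mathcal{X}$, with the $\sigma$-algebra generated by the cylinder sets, and $X_n(\omega)=\omega(n)$; $X_{0:n}=(X_0,\dots,X_n)$, $x_{0:n}=(x_0,\dots,x_n)$. A stochastic process $P$ is a probability measure on $\Omega$; it is understood as given by an initial mass function together with conditional mass functions $P(X_{n+1}=\cdot\,|\,X_{0:n}=x_{0:n})$ specified for every $n\in\mathbb{N}_0$ and every $x_{0:n}\in\mathcal{X}^{n+1}$, and $P(\cdot\,|\,X_{0:n}=x_{0:n})$ is the corresponding probability measure on paths starting with $x_{0:n}$, with $\mathbb{E}_P[\cdot\,|\,X_{0:n}=x_{0:n}]$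 its expectation. $P$ is a homogeneous Markov chain with transition matrix $T$ if $P(X_{n+1}=y\,|\,X_{0:n}=x_{0:n})=T(x_n,y)$ for all $n,x_{0:n},y$. Imprecise Markov chains. $\mathcal{P}_{\mathcal{T}}^{\mathrm{H}}$ is the set of all homogeneous Markov chains whose transition matrix belongs to $\mathcal{T}$. $\mathcal{P}_{\mathcal{T}}^{\mathrm{I}}$ is the set of all stochastic processes $P$ such that for all $n$ and $x_{0:n}$ there is a $T\in\mathcal{T}$ with $P(X_{n+1}=y\,|\,X_{0:n}=x_{0:n})=T(x_n,y)$ for all $y\in\mathcal{X}$. For $\star\in\{\mathrm{H},\mathrm{I}\}$, $\underline{\mathbb{E}}_{\mathcal{T}}^{\star}[\cdot|\cdot]=\inf_{P\in\mathcal{P}_{\mathcal{T}}^{\star}}\mathbb{E}_P[\cdot|\cdot]$ and $\overline{\mathbb{E}}_{\mathcal{T}}^{\star}[\cdot|\cdot]=\sup_{P\in\mathcal{P}_{\mathcal{T}}^{\star}}\mathbb{E}_P[\cdot|\cdot]$. Game-theoretic imprecise Markov chain. Let $\mathbb{S}=\{x_{0:n}\in\mathcal{X}^{n+1}:n\in\mathbb{N}_0\}$ be the set of situations and $\Box$ the empty string. Put $\overline{Q}_{x_{0:n}}(f)=[\overline{T}f](x_n)$ for $f\in\mathcal{L}^{+\infty}(\mathcal{X})$; $\overline{Q}_\Box:\mathcal{L}^{+\infty}(\mathcal{X})\to\mathbb{R}\cup\{+\infty\}$ is any operator that maps real constants to themselves, is subadditive, monotone, and satisfies $\overline{Q}_\Box(\lambda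 f)=\lambda\overline{Q}_\Box(f)$ for all positive $\lambda\in\mathbb{R}\cup\{+\infty\}$ and non-negative $f$ (its choice does not affect what follows). A supermartingale is a map $\mathcal{M}:\mathbb{S}\cup\{\Box\}\to\mathbb{R}\cup\{-\infty,+\infty\}$ that is uniformly bounded below by a real number and satisfies $\overline{Q}_s(\mathcal{M}(s\,\cdot))\le\mathcal{M}(s)$ for all $s$, where $\mathcal{M}(s\,\cdot)$ is the function $x\mapsto\mathcal{M}(sx)$. For $f:\Omega\to\mathbb{R}\cup\{\pm\infty\}$ and $s=x_{0:n}$, $\overline{\mathbb{E}}_{\mathcal{T}}^{\mathrm{V}}[f\,|\,X_{0:n}=x_{0:n}]$ is the infimum of $\mathcal{M}(s)$ over all supermartingales $\mathcal{M}$ such that $\liminf_{m\to+\infty}\mathcal{M}(\omega(0),\dots,\omega(m))\ge f(\omega)$ for every path $\omega$ with $(\omega(0),\dots,\omega(n))=x_{0:n}$. The lower expectation is $\underline{\mathbb{E}}_{\mathcal{T}}^{\mathrm{V}}[f|\cdot]=-\overline{\mathbb{E}}_{\mathcal{T}}^{\mathrm{V}}[-f|\cdot]$. Hitting indicator. $G_A:\Omega\to\{0,1\}$ is defined by $G_A(\omega)=1$ if $\omega(t)\in A$ for some $t\in\mathbb{N}_0$, and $G_A(\omega)=0$ otherwise. *)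

theory Defs
  imports "HOL-Probability.Probability"
begin

section \<open>Transition matrices\<close>

text \<open>The finite non-empty state space is the type \<open>'x :: finite\<close>.  Matrices live in
  \<open>real ^ 'x ^ 'x\<close>, with \<open>T $ x $ y\<close> the entry in row \<open>x\<close> and column \<open>y\<close>, so that
  \<^const>\<open>closed\<close> and \<^const>\<open>convex\<close> have their usual Euclidean meaning.\<close>

definition transition_matrix :: "real ^ 'x ^ 'x \<Rightarrow> bool" where
  "transition_matrix T \<longleftrightarrow> (\<forall>x y. 0 \<le> T $ x $ y) \<and> (\<forall>x. (\<Sum>y\<in>UNIV. T $ x $ y) = 1)"

definition separately_specified_rows :: "(real ^ 'x ^ 'x) set \<Rightarrow> bool" where
  "separately_specified_rows \<T> \<longleftrightarrow>
     (\<forall>S :: 'x \<Rightarrow> real ^ 'x ^ 'x. (\<forall>x. S x \<in> \<T>) \<longrightarrow> (\<exists>T\<in>\<T>. \<forall>x. T $ x = S x $ x))"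

text \<open>The functions with values in the reals extended by \<open>+\<infinity>\<close> only.\<close>

definition no_minus_infinity :: "('x \<Rightarrow> ereal) set" where
  "no_minus_infinity = {f. \<forall>x. f x \<noteq> -\<infinity>}"

text \<open>In \<^typ>\<open>ereal\<close>, \<open>0 * \<infinity> = 0\<close> as required.\<close>

definition apply_matrix :: "real ^ 'x ^ 'x \<Rightarrow> ('x \<Rightarrow> ereal) \<Rightarrow> 'x \<Rightarrow> ereal" where
  "apply_matrix T f x = (\<Sum>y\<in>UNIV. ereal (T $ x $ y) * f y)"

definition upper_transition :: "(real ^ 'x ^ 'x) set \<Rightarrow> ('x \<Rightarrow> ereal) \<Rightarrow> 'x \<Rightarrow> ereal" where
  "upper_transition \<T> f x = (SUP T\<in>\<T>. apply_matrix T f x)"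


section \<open>Stochastic processes\<close>

type_synonym 'x path = "nat \<Rightarrow> 'x"

text \<open>A finite string \<open>x\<^sub>0 \<dots> x\<^sub>n\<close> is a list of length \<open>n + 1\<close>; the empty list is the empty string.\<close>

definition prefix_of :: "'x path \<Rightarrow> nat \<Rightarrow> 'x list" where
  "prefix_of \<omega> n = map \<omega> [0..<n]"

definition cylinder :: "'x list \<Rightarrow> 'x path set" where
  "cylinder s = {\<omega>. prefix_of \<omega> (length s) = s}"

definition path_space :: "'x path measure" where
  "path_space = sigma UNIV (range cylinder)"

text \<open>A stochastic process \<open>p\<close> consists of its initial mass function \<open>p []\<close> and, for each
  non-empty string \<open>s\<close>, the conditional mass function \<open>p s\<close> of the next state given \<open>s\<close>.
  These are specified also when the string has probability zero.\<close>

type_synonym 'x process = "'x list \<Rightarrow> 'x pmf"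

definition is_path_measure :: "'x process \<Rightarrow> 'x list \<Rightarrow> 'x path measure \<Rightarrow> bool" where
  "is_path_measure p s M \<longleftrightarrow>
     prob_space M \<and> sets M = sets path_space \<and>
     measure M (cylinder s) = 1 \<and>
     (\<forall>t y. length s \<le> length t \<longrightarrow>
        measure M (cylinder (t @ [y])) = measure M (cylinder t) * pmf (p t) y)"

text \<open>The process started from \<open>s\<close>: the unique measure on paths that is concentrated on
  \<open>cylinder s\<close> and then evolves according to the conditional mass functions of \<open>p\<close>.  Existence
  and uniqueness are shown in \<open>path_measure\<close> and \<open>is_path_measure_unique\<close> below.  The
  (unconditional) probability measure of the process is \<open>path_measure p []\<close>.\<close>

definition path_measure :: "'x process \<Rightarrow> 'x list \<Rightarrow> 'x path measure" where
  "path_measure p s = (THE M. is_path_measure p s M)"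

definition expectation_given :: "'x process \<Rightarrow> ('x path \<Rightarrow> real) \<Rightarrow> 'x list \<Rightarrow> real" where
  "expectation_given p f s = (\<integral>\<omega>. f \<omega> \<partial>path_measure p s)"


section \<open>Imprecise Markov chains\<close>

definition homogeneous_chains :: "(real ^ 'x ^ 'x) set \<Rightarrow> 'x process set" where
  "homogeneous_chains \<T> =
     {p. \<exists>T\<in>\<T>. \<forall>s. s \<noteq> [] \<longrightarrow> (\<forall>y. pmf (p s) y = T $ last s $ y)}"

definition compatible_processes :: "(real ^ 'x ^ 'x) set \<Rightarrow> 'x process set" where
  "compatible_processes \<T> =
     {p. \<forall>s. s \<noteq> [] \<longrightarrow> (\<exists>T\<in>\<T>. \<forall>y. pmf (p s) y = T $ last s $ y)}"

text \<open>Infima and suprema are taken in \<^typ>\<open>ereal\<close>, where they always exist.\<close>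

definition lower_expectation :: "'x process set \<Rightarrow> ('x path \<Rightarrow> real) \<Rightarrow> 'x list \<Rightarrow> ereal" where
  "lower_expectation \<P> f s = (INF p\<in>\<P>. ereal (expectation_given p f s))"

definition upper_expectation :: "'x process set \<Rightarrow> ('x path \<Rightarrow> real) \<Rightarrow> 'x list \<Rightarrow> ereal" where
  "upper_expectation \<P> f s = (SUP p\<in>\<P>. ereal (expectation_given p f s))"


section \<open>The game-theoretic imprecise Markov chain\<close>

text \<open>Only the values of \<open>Q\<close> on \<^const>\<open>no_minus_infinity\<close> matter.\<close>

definition initial_upper_operator :: "(('x \<Rightarrow> ereal) \<Rightarrow> ereal) \<Rightarrow> bool" where
  "initial_upper_operator Q \<longleftrightarrow>
     (\<forall>f\<in>no_minus_infinity. Q f \<noteq> -\<infinity>) \<and>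
     (\<forall>c :: real. Q (\<lambda>_. ereal c) = ereal c) \<and>
     (\<forall>f\<in>no_minus_infinity. \<forall>g\<in>no_minus_infinity. Q (\<lambda>x. f x + g x) \<le> Q f + Q g) \<and>
     (\<forall>f\<in>no_minus_infinity. \<forall>g\<in>no_minus_infinity. (\<forall>x. f x \<le> g x) \<longrightarrow> Q f \<le> Q g) \<and>
     (\<forall>c :: ereal. \<forall>f. 0 < c \<longrightarrow> (\<forall>x. 0 \<le> f x) \<longrightarrow> Q (\<lambda>x. c * f x) = c * Q f)"

definition local_upper ::
  "(('x \<Rightarrow> ereal) \<Rightarrow> ereal) \<Rightarrow> (real ^ 'x ^ 'x) set \<Rightarrow> 'x list \<Rightarrow> ('x \<Rightarrow> ereal) \<Rightarrow> ereal" where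
  "local_upper Q \<T> s f = (if s = [] then Q f else upper_transition \<T> f (last s))"

definition supermartingale ::
  "(('x \<Rightarrow> ereal) \<Rightarrow> ereal) \<Rightarrow> (real ^ 'x ^ 'x) set \<Rightarrow> ('x list \<Rightarrow> ereal) \<Rightarrow> bool" where
  "supermartingale Q \<T> M \<longleftrightarrow>
     (\<exists>B :: real. \<forall>s. ereal B \<le> M s) \<and>
     (\<forall>s. local_upper Q \<T> s (\<lambda>x. M (s @ [x])) \<le> M s)"

text \<open>For \<open>s = x\<^sub>0 \<dots> x\<^sub>n\<close>, conditioning on \<open>s\<close> is conditioning on \<open>X\<^sub>0 = x\<^sub>0, \<dots>, X\<^sub>n = x\<^sub>n\<close>.\<close>

definition upper_V ::
  "(('x \<Rightarrow> ereal) \<Rightarrow> ereal) \<Rightarrow> (real ^ 'x ^ 'x) set \<Rightarrow> ('x path \<Rightarrow> ereal) \<Rightarrow> 'x list \<Rightarrow> ereal" where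
  "upper_V Q \<T> f s =
     Inf {M s | M. supermartingale Q \<T> M \<and>
       (\<forall>\<omega>\<in>cylinder s. f \<omega> \<le> liminf (\<lambda>m. M (prefix_of \<omega> (Suc m))))}"

definition lower_V ::
  "(('x \<Rightarrow> ereal) \<Rightarrow> ereal) \<Rightarrow> (real ^ 'x ^ 'x) set \<Rightarrow> ('x path \<Rightarrow> ereal) \<Rightarrow> 'x list \<Rightarrow> ereal" where
  "lower_V Q \<T> f s = - upper_V Q \<T> (\<lambda>\<omega>. - f \<omega>) s"


section \<open>The hitting indicator\<close>

definition hits :: "'x set \<Rightarrow> 'x path \<Rightarrow> real" where
  "hits A \<omega> = (if \<exists>t. \<omega> t \<in> A then 1 else 0)"


section \<open>Existence and uniqueness of the path measure\<close>

lemma length_prefix_of [simp]: "length (prefix_of \<omega> n) = n"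
  by (simp add: prefix_of_def)

lemma cylinder_iff: "\<omega> \<in> cylinder t \<longleftrightarrow> (\<forall>i<length t. \<omega> i = t ! i)"
  unfolding cylinder_def prefix_of_def mem_Collect_eq list_eq_iff_nth_eq by simp

lemma cylinder_Nil [simp]: "cylinder [] = UNIV"
  by (auto simp: cylinder_iff)

lemma cylinder_subset_or_disjoint:
  assumes "length s \<le> length t"
  shows "cylinder t \<subseteq> cylinder s \<or> cylinder s \<inter> cylinder t = {}"
proof (cases "\<forall>i<length s. s ! i = t ! i")
  case True
  have "\<omega> \<in> cylinder s" if "\<omega> \<in> cylinder t" for \<omega>
    unfolding cylinder_iff
  proof (intro allI impI)
    fix i assume i: "i < length s"
    then have "\<omega> i = t ! i" using that assms unfolding cylinder_iff by simp
    then show "\<omega> i = s ! i" using True i by simp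
  qed
  then show ?thesis by blast
next
  case False
  then obtain i where i: "i < length s" "s ! i \<noteq> t ! i" by blast
  then have "i < length t" using assms by simp
  then have "\<not> (\<omega> \<in> cylinder s \<and> \<omega> \<in> cylinder t)" for \<omega>
    using i by (metis cylinder_iff)
  then show ?thesis by blast
qed

lemma cylinder_disjoint: "length s = length t \<Longrightarrow> s \<noteq> t \<Longrightarrow> cylinder s \<inter> cylinder t = {}"
  by (auto simp: cylinder_def)

lemma Int_stable_cylinders: "Int_stable (insert {} (range cylinder))"
proof (rule Int_stableI)
  fix a b :: "'x path set"
  assume "a \<in> insert {} (range cylinder)" "b \<in> insert {} (range cylinder)"
  then consider "a = {} \<or> b = {}" | s t where "a = cylinder s" "b = cylinder t" by blast
  then show "a \<inter> b \<in> insert {} (range cylinder)"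
  proof cases
    case 2
    have "a \<subseteq> b \<or> b \<subseteq> a \<or> a \<inter> b = {}"
      using cylinder_subset_or_disjoint[of s t] cylinder_subset_or_disjoint[of t s]
      unfolding 2 by (metis Int_commute linear)
    then have "a \<inter> b = {} \<or> a \<inter> b = a \<or> a \<inter> b = b" by blast
    then show ?thesis using 2 by (metis insertCI rangeI)
  qed auto
qed

lemma space_path_space [simp]: "space path_space = UNIV"
  by (simp add: path_space_def)

lemma sets_path_space: "sets path_space = sigma_sets UNIV (range cylinder)"
  by (simp add: path_space_def)

lemma cylinder_in_sets [measurable, simp]: "cylinder s \<in> sets path_space"
  by (simp add: sets_path_space)

lemma sets_path_space_eq_PiM:
  "sets (path_space :: 'x::finite path measure) = sets (PiM UNIV (\<lambda>_. count_space UNIV))"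
proof
  show "sets (path_space :: 'x path measure) \<subseteq> sets (PiM UNIV (\<lambda>_. count_space UNIV))"
  proof -
    have space: "space (PiM UNIV (\<lambda>_::nat. count_space (UNIV :: 'x set))) = UNIV"
      by (simp add: space_PiM)
    have "cylinder t \<in> sets (PiM UNIV (\<lambda>_::nat. count_space (UNIV :: 'x set)))" for t
    proof -
      have "cylinder t = {\<omega> \<in> space (PiM UNIV (\<lambda>_. count_space UNIV)). \<forall>i<length t. \<omega> i = t ! i}"
        unfolding space set_eq_iff by (simp add: cylinder_iff)
      also have "\<dots> \<in> sets (PiM UNIV (\<lambda>_::nat. count_space (UNIV :: 'x set)))"
        by measurable
      finally show ?thesis .
    qed
    then show ?thesis
      unfolding sets_path_space space[symmetric] by (intro sets.sigma_sets_subset) blast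
  qed
next
  have coord: "(\<lambda>\<omega>. \<omega> i) \<in> measurable path_space (count_space (UNIV :: 'x set))" for i
  proof (rule measurable_count_space_eq2[THEN iffD2, OF finite], intro conjI ballI)
    fix a :: 'x
    have "(\<lambda>\<omega>. \<omega> i) -` {a} \<inter> space path_space =
        (\<Union>t \<in> {t. length t = Suc i \<and> t ! i = a}. cylinder t)"
    proof safe
      fix \<omega> :: "'x path"
      show "\<omega> \<in> (\<Union>t \<in> {t. length t = Suc i \<and> t ! i = \<omega> i}. cylinder t)"
        by (rule UN_I[of "prefix_of \<omega> (Suc i)"])
          (auto simp: cylinder_iff prefix_of_def simp del: upt_Suc)
    qed (auto simp: cylinder_iff)
    also have "\<dots> \<in> sets path_space"
      by (intro sets.countable_UN') auto
    finally show "(\<lambda>\<omega>. \<omega> i) -` {a} \<inter> space path_space \<in> sets path_space" .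
  qed auto
  have "(\<lambda>\<omega>. \<omega>) \<in> measurable path_space (PiM UNIV (\<lambda>_::nat. count_space (UNIV :: 'x set)))"
    by (rule measurable_PiM_single') (use coord in auto)
  then show "sets (PiM UNIV (\<lambda>_. count_space UNIV)) \<subseteq> sets (path_space :: 'x path measure)"
    by (auto dest: measurable_sets)
qed

lemma is_path_measure_unique:
  assumes M: "is_path_measure p s M" and N: "is_path_measure p s N"
  shows "M = N"
proof -
  have short: "measure L (cylinder t) = (if cylinder s \<subseteq> cylinder t then 1 else 0)"
    if L: "is_path_measure p s L" and le: "length t \<le> length s" for L and t :: "'a list"
  proof -
    interpret L: prob_space L using L by (simp add: is_path_measure_def)
    have [simp]: "sets L = sets path_space" and one: "measure L (cylinder s) = 1"
      using L by (simp_all add: is_path_measure_def)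
    show ?thesis
    proof (cases "cylinder s \<subseteq> cylinder t")
      case True
      then have "measure L (cylinder s) \<le> measure L (cylinder t)"
        by (intro L.finite_measure_mono) simp_all
      then show ?thesis using one True L.prob_le_1[of "cylinder t"] by simp
    next
      case False
      then have "cylinder t \<inter> cylinder s = {}"
        using cylinder_subset_or_disjoint[OF le] by blast
      then have "measure L (cylinder t \<union> cylinder s) = measure L (cylinder t) + measure L (cylinder s)"
        by (intro L.finite_measure_Union) simp_all
      then have "measure L (cylinder t) \<le> 0"
        using one L.prob_le_1[of "cylinder t \<union> cylinder s"] by simp
      then show ?thesis using False by (simp add: measure_le_0_iff)
    qed
  qed
  have mass: "measure M (cylinder t) = measure N (cylinder t)" for t
  proof (induction t rule: rev_induct)
    case Nil
    show ?case using short[OF M, of "[]"] short[OF N, of "[]"] by simp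
  next
    case (snoc y t)
    show ?case
    proof (cases "length (t @ [y]) \<le> length s")
      case True
      then show ?thesis using short[OF M True] short[OF N True] by simp
    next
      case False
      then have "length s \<le> length t" by simp
      then show ?thesis using M N snoc.IH unfolding is_path_measure_def by metis
    qed
  qed
  interpret M: prob_space M using M by (simp add: is_path_measure_def)
  interpret N: prob_space N using N by (simp add: is_path_measure_def)
  have setsM: "sets M = sigma_sets UNIV (insert {} (range cylinder))"
    and setsN: "sets N = sigma_sets UNIV (insert {} (range cylinder))"
  proof -
    have "sigma_sets UNIV (insert {} (range cylinder)) =
        sigma_sets UNIV (range (cylinder :: 'a list \<Rightarrow> _))"
      by (rule sigma_sets_eqI) (auto intro: sigma_sets.Empty)
    then show "sets M = sigma_sets UNIV (insert {} (range cylinder))"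
      "sets N = sigma_sets UNIV (insert {} (range cylinder))"
      using M N by (auto simp: is_path_measure_def sets_path_space)
  qed
  show "M = N"
  proof (rule measure_eqI_generator_eq[where A = "\<lambda>_. UNIV" and \<Omega> = UNIV,
      OF Int_stable_cylinders _ _ setsM setsN])
    show "emeasure M X = emeasure N X" if "X \<in> insert {} (range cylinder)" for X
      using that mass by (auto simp: M.emeasure_eq_measure N.emeasure_eq_measure)
    show "range (\<lambda>_. UNIV) \<subseteq> insert {} (range cylinder)"
      using cylinder_Nil by blast
  qed auto
qed

lemma is_path_measure_exists:
  fixes p :: "'x::finite process"
  shows "\<exists>M. is_path_measure p s M"
proof -
  define K where "K i \<omega> =
    measure_pmf (if i < length s then return_pmf (s ! i) else p (prefix_of \<omega> i))"
    for i and \<omega> :: "'x path"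
  let ?M = "\<lambda>_::nat. count_space (UNIV :: 'x set)"
  have PiM: "PiM {0..<i} ?M = count_space (PiE {0..<i} (\<lambda>_. UNIV))" for i
    by (rule count_space_PiM_finite) auto
  interpret Ionescu_Tulcea K ?M
  proof (rule Ionescu_Tulcea.intro)
    show "K i \<in> measurable (PiM {0..<i} ?M) (subprob_algebra (?M i))" for i
      unfolding PiM by (auto simp: K_def measure_pmf_in_subprob_algebra)
    show "prob_space (K i \<omega>)" for i \<omega>
      unfolding K_def by (rule measure_pmf.prob_space_axioms)
  qed
  define r where "r t = (\<lambda>i\<in>{0..<length t}. t ! i)" for t :: "'x list"
  have r_in: "r t \<in> space (PiM {0..<length t} ?M)" for t
    by (auto simp: r_def space_PiM)
  have r_sets: "{r t} \<in> sets (PiM {0..<length t} ?M)" for t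
    using r_in[of t] unfolding PiM by auto
  let ?u = "\<lambda>_. undefined"
  have u: "?u \<in> space (PiM {0..<0} ?M)" by (simp add: space_PiM)
  have sp: "space PF.lim = UNIV" "sets PF.lim = sets path_space"
    by (simp_all add: PF.space_lim PF.sets_lim space_PiM sets_path_space_eq_PiM)
  have cyl: "cylinder t = PF.emb UNIV {0..<length t} {r t}" for t
    by (simp add: set_eq_iff cylinder_iff prod_emb_def r_def space_PiM fun_eq_iff restrict_def)
  have lim_cyl: "emeasure PF.lim (cylinder t) = emeasure (C 0 (length t) ?u) {r t}" for t
  proof -
    have "emeasure PF.lim (cylinder t) = emeasure (CI {0..<length t}) {r t}"
      unfolding cyl by (rule lim) (use r_sets in auto)
    also have "\<dots> = emeasure (C 0 (length t) ?u) (PF.emb {0..<length t} {0..<length t} {r t})"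
      by (rule emeasure_CI) (use r_sets in auto)
    also have "PF.emb {0..<length t} {0..<length t} {r t} = {r t}"
      using r_sets[of t] by (intro prod_emb_id) (auto simp: r_def)
    finally show ?thesis .
  qed
  have step: "emeasure PF.lim (cylinder (t @ [y])) =
      emeasure PF.lim (cylinder t) * emeasure (K (length t) (r t)) {y}" for t y
  proof -
    let ?n = "length t"
    have sets': "{r (t @ [y])} \<in> sets (PiM {0..<Suc ?n} ?M)"
      using r_sets[of "t @ [y]"] by simp
    have spC: "space (C 0 ?n ?u) = space (PiM {0..<?n} ?M)"
      using space_C[OF u, of ?n] by simp
    have setsC: "sets (C 0 ?n ?u) = sets (PiM {0..<?n} ?M)"
      using sets_C[OF u, of ?n] by simp
    have upd: "fun_upd \<omega> ?n x = r (t @ [y]) \<longleftrightarrow> \<omega> = r t \<and> x = y"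
      if "\<omega> \<in> space (PiM {0..<?n} ?M)" for \<omega> x
    proof
      assume eq: "fun_upd \<omega> ?n x = r (t @ [y])"
      have "\<omega> i = r t i" for i
      proof (cases "i < ?n")
        case True
        then show ?thesis using fun_cong[OF eq, of i] by (simp add: r_def nth_append)
      next
        case False
        then show ?thesis using that by (auto simp: r_def space_PiM PiE_iff extensional_def)
      qed
      moreover have "x = y" using fun_cong[OF eq, of ?n] by (simp add: r_def)
      ultimately show "\<omega> = r t \<and> x = y" by auto
    next
      assume "\<omega> = r t \<and> x = y"
      then show "fun_upd \<omega> ?n x = r (t @ [y])"
        by (auto simp: r_def fun_eq_iff nth_append)
    qed
    have "emeasure PF.lim (cylinder (t @ [y])) =
        emeasure (C 0 ?n ?u \<bind> eP (0 + ?n)) {r (t @ [y])}"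
      by (subst lim_cyl) simp
    also have "\<dots> = (\<integral>\<^sup>+\<omega>. emeasure (eP ?n \<omega>) {r (t @ [y])} \<partial>C 0 ?n ?u)"
    proof (subst emeasure_bind)
      show "space (C 0 ?n ?u) \<noteq> {}" using spC r_in[of t] by auto
      show "eP (0 + ?n) \<in> measurable (C 0 ?n ?u) (subprob_algebra (PiM {0..<Suc ?n} ?M))"
        using measurable_eP[of ?n] by (simp add: measurable_cong_sets[OF setsC refl])
    qed (use sets' in auto)
    also have "\<dots> = (\<integral>\<^sup>+\<omega>. emeasure (K ?n (r t)) {y} * indicator {r t} \<omega> \<partial>C 0 ?n ?u)"
    proof (rule nn_integral_cong)
      fix \<omega> assume "\<omega> \<in> space (C 0 ?n ?u)"
      then have \<omega>: "\<omega> \<in> space (PiM {0..<?n} ?M)" using spC by simp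
      have "(\<lambda>x. fun_upd \<omega> ?n x) -` {r (t @ [y])} \<inter> UNIV = (if \<omega> = r t then {y} else {})"
        using upd[OF \<omega>] by auto
      then show "emeasure (eP ?n \<omega>) {r (t @ [y])} = emeasure (K ?n (r t)) {y} * indicator {r t} \<omega>"
        using emeasure_eP[OF \<omega> sets'] by simp
    qed
    also have "\<dots> = emeasure (K ?n (r t)) {y} * emeasure (C 0 ?n ?u) {r t}"
      using r_sets[of t] setsC by (intro nn_integral_cmult_indicator) simp
    finally show ?thesis by (simp add: lim_cyl mult.commute)
  qed
  have pre: "prefix_of (r t) (length t) = t" for t
    by (rule nth_equalityI) (simp_all add: prefix_of_def r_def)
  interpret lim: prob_space PF.lim
  proof (rule prob_spaceI)
    have "r [] = ?u" by (simp add: r_def restrict_def)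
    then show "emeasure PF.lim (space PF.lim) = 1"
      using lim_cyl[of "[]"] r_sets[of "[]"] unfolding sp by simp
  qed
  have init: "measure PF.lim (cylinder (take n s)) = 1" if "n \<le> length s" for n
    using that
  proof (induction n)
    case 0
    show ?case using lim.prob_space sp by simp
  next
    case (Suc n)
    have "take (Suc n) s = take n s @ [s ! n]"
      using Suc.prems by (simp add: take_Suc_conv_app_nth)
    then have "emeasure PF.lim (cylinder (take (Suc n) s)) =
        emeasure PF.lim (cylinder (take n s)) * emeasure (K n (r (take n s))) {s ! n}"
      using step[of "take n s" "s ! n"] Suc.prems by simp
    also have "emeasure (K n (r (take n s))) {s ! n} = 1"
      using Suc.prems by (simp add: K_def emeasure_pmf_single)
    also have "emeasure PF.lim (cylinder (take n s)) * 1 = 1"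
      using Suc by (simp add: lim.emeasure_eq_measure)
    finally show ?case by (simp add: lim.emeasure_eq_measure)
  qed
  have "is_path_measure p s PF.lim"
    unfolding is_path_measure_def
  proof (intro conjI allI impI)
    show "prob_space PF.lim" by (rule lim.prob_space_axioms)
    show "sets PF.lim = sets path_space" by (rule sp)
    show "measure PF.lim (cylinder s) = 1" using init[of "length s"] by simp
    show "measure PF.lim (cylinder (t @ [y])) = measure PF.lim (cylinder t) * pmf (p t) y"
      if "length s \<le> length t" for t y
    proof -
      have "emeasure (K (length t) (r t)) {y} = ennreal (pmf (p t) y)"
        using that by (simp add: K_def pre emeasure_pmf_single)
      then show ?thesis
        using step[of t y] by (simp add: measure_def enn2real_mult)
    qed
  qed
  then show ?thesis by blast
qed

lemma path_measure:
  fixes p :: "'x::finite process"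
  shows "is_path_measure p s (path_measure p s)"
  unfolding path_measure_def
  using is_path_measure_exists[of p s] is_path_measure_unique[of p s] by (metis theI')

lemma hits_measurable:
  "hits (A :: 'x::finite set) \<in> borel_measurable (path_measure p s)"
proof -
  have "sets (path_measure p s) = sets (PiM UNIV (\<lambda>_. count_space UNIV))"
    using path_measure[of p s] by (simp add: is_path_measure_def sets_path_space_eq_PiM)
  moreover have "hits A \<in> borel_measurable (PiM UNIV (\<lambda>_. count_space UNIV))"
    unfolding hits_def by measurable
  ultimately show ?thesis using measurable_cong_sets by blast
qed

end

theory Submission
  imports Defs
begin

text \<open>
  All inequalities come from exhibiting supermartingales.  By Fatou's lemma, a supermartingale that
  is bounded below and dominates a bounded variable along every path dominates its expectation under
  every compatible process (\<open>expectation_le_supermartingale\<close>).  Hence the game-theoretic expectations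
  enclose those over compatible processes, which in turn enclose those over homogeneous chains,
  and it remains to bound the outermost expectation by the innermost one.

  The supermartingales all have one shape: a function of time and current state, stopped when
  the path first enters \<open>A\<close>.  Applied to the whole family of matrices they bound the game-theoretic
  expectation (\<open>upper_V_hits_le\<close>); applied to a single matrix they bound the hitting probability
  of its chain (\<open>expectation_hits_le\<close>), without any first-step analysis.

  For the lower expectation, let \<open>l n x\<close> be the minimal probability of hitting \<open>A\<close> within a horizon
  of \<open>n\<close> states from \<open>x\<close>, computed by backward recursion, and let \<open>l\<close> be its limit.  The stopped value
  \<open>- l (N - n) x\<close> at time \<open>n\<close> shows that the lower game-theoretic expectation is at least \<open>l N\<close>,
  hence at least \<open>l\<close>.  As the rows range over compact sets and are chosen independently, one matrix
  \<open>T\<close> minimises \<open>T l\<close> in all rows at once; then \<open>T l \<le> l\<close> outside \<open>A\<close>, so stopping \<open>l\<close> itself bounds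
  the hitting probability of the chain of \<open>T\<close> from above by \<open>l\<close>.  This chain is the optimal one.

  For the upper expectation, let \<open>u\<close> be the limit of the maximal probabilities.  It satisfies
  \<open>T u \<le> u\<close> for all \<open>T\<close>, so stopping \<open>u\<close> bounds the upper game-theoretic expectation by \<open>u\<close>.  A
  maximiser of \<open>T u\<close>, however, need not yield a good chain: it may move for ever among states where
  \<open>u\<close> is large without entering \<open>A\<close>.  Discounting by a factor \<open>\<delta> < 1\<close> penalises such delay.  If \<open>v\<close>
  is the discounted value and \<open>T\<close> maximises \<open>T v\<close>, then \<open>\<delta> ^ n * v x\<close>, stopped, is a
  submartingale for \<open>T\<close> that tends to \<open>0\<close> on paths missing \<open>A\<close>, so the chain of \<open>T\<close> hits
  \<open>A\<close> with probability at least \<open>v\<close>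
  (\<open>homogeneous_chain_ge_discounted_limit\<close>).  Over horizon \<open>n\<close> the discounted value loses at most a
  factor \<open>\<delta> ^ n\<close>, so letting \<open>\<delta> \<rightarrow> 1\<close> and then \<open>n \<rightarrow> \<infinity>\<close> recovers \<open>u\<close> as a supremum over
  homogeneous chains.
\<close>


section \<open>Supermartingales bound expectations\<close>

lemma finite_strings_of_length [simp]: "finite {t :: 'x::finite list. length t = n}"
  using finite_lists_length_eq[of "UNIV :: 'x set" n] by simp

lemma sum_strings_Suc:
  fixes h :: "'x::finite list \<Rightarrow> 'b::comm_monoid_add"
  shows "(\<Sum>t | length t = Suc n. h t) = (\<Sum>t | length t = n. \<Sum>y\<in>UNIV. h (t @ [y]))"
proof -
  have "(\<Sum>t | length t = n. \<Sum>y\<in>UNIV. h (t @ [y]))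
      = (\<Sum>(t, y)\<in>{t. length t = n} \<times> UNIV. h (t @ [y]))"
    by (simp add: sum.cartesian_product)
  also have "\<dots> = (\<Sum>t | length t = Suc n. h t)"
  proof (rule sum.reindex_bij_witness[where j = "\<lambda>(t, y). t @ [y]" and i = "\<lambda>t. (butlast t, last t)"])
    fix t :: "'x list" assume "t \<in> {t. length t = Suc n}"
    then have "t \<noteq> []" by auto
    then show "(case (butlast t, last t) of (t, y) \<Rightarrow> t @ [y]) = t" by simp
  qed auto
  finally show ?thesis by simp
qed

lemma prefix_of_eq_iff: "prefix_of \<omega> (length t) = t \<longleftrightarrow> \<omega> \<in> cylinder t"
  by (simp add: cylinder_def)

lemma nn_integral_prefix_of:
  fixes \<mu> :: "'x::finite path measure" and N :: "'x list \<Rightarrow> ennreal"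
  assumes "sets \<mu> = sets path_space"
  shows "(\<lambda>\<omega>. N (prefix_of \<omega> n)) \<in> borel_measurable \<mu>"
    and "(\<integral>\<^sup>+\<omega>. N (prefix_of \<omega> n) \<partial>\<mu>) = (\<Sum>t | length t = n. N t * emeasure \<mu> (cylinder t))"
proof -
  have N: "N (prefix_of \<omega> n) = (\<Sum>t | length t = n. N t * indicator (cylinder t) \<omega>)" for \<omega>
  proof -
    have "(\<Sum>t | length t = n. N t * indicator (cylinder t) \<omega>)
        = (\<Sum>t | length t = n. if t = prefix_of \<omega> n then N t else 0)"
      by (rule sum.cong) (auto simp: indicator_def prefix_of_eq_iff[symmetric])
    then show ?thesis by simp
  qed
  have [measurable]: "cylinder t \<in> sets \<mu>" for t
    using assms by simp
  show "(\<lambda>\<omega>. N (prefix_of \<omega> n)) \<in> borel_measurable \<mu>"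
    unfolding N by measurable
  show "(\<integral>\<^sup>+\<omega>. N (prefix_of \<omega> n) \<partial>\<mu>) = (\<Sum>t | length t = n. N t * emeasure \<mu> (cylinder t))"
    unfolding N
    by (subst nn_integral_sum, measurable) (simp add: nn_integral_cmult_indicator assms)
qed

text \<open>Subtracting the lower bound \<open>B\<close> moves a supermartingale into the non-negative extended reals,
  where expectations exist unconditionally.  The local inequality survives because each row is a
  probability vector: averaging commutes with subtracting a real constant.\<close>

lemma supermartingale_shift_step:
  assumes M: "supermartingale Q \<T> M" and B: "\<And>t. ereal B \<le> M t"
    and p: "p \<in> compatible_processes \<T>" and t: "t \<noteq> []"
  shows "(\<Sum>y\<in>UNIV. e2ennreal (M (t @ [y]) - ereal B) * ennreal (pmf (p t) y))
      \<le> e2ennreal (M t - ereal B)"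
proof -
  obtain T where T: "T \<in> \<T>" "\<And>y. pmf (p t) y = T $ last t $ y"
    using p t unfolding compatible_processes_def by blast
  have fin: "M s \<noteq> -\<infinity>" for s
    using B[of s] by auto
  have "apply_matrix T (\<lambda>y. M (t @ [y])) (last t)
      \<le> upper_transition \<T> (\<lambda>y. M (t @ [y])) (last t)"
    unfolding upper_transition_def by (rule SUP_upper[OF T(1)])
  also have "\<dots> = local_upper Q \<T> t (\<lambda>y. M (t @ [y]))"
    using t by (simp add: local_upper_def)
  also have "\<dots> \<le> M t"
    using M unfolding supermartingale_def by blast
  finally have step: "(\<Sum>y\<in>UNIV. ereal (pmf (p t) y) * M (t @ [y])) \<le> M t"
    by (simp add: apply_matrix_def T)
  have split: "ereal (pmf (p t) y) * (M (t @ [y]) - ereal B)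
      = ereal (pmf (p t) y) * M (t @ [y]) + ereal (- (pmf (p t) y * B))" for y
    using fin[of "t @ [y]"] by (cases "M (t @ [y])") (auto simp: algebra_simps)
  have one: "(\<Sum>y\<in>UNIV. - (pmf (p t) y * B)) = - B"
    using sum_pmf_eq_1[of UNIV "p t"]
    by (simp add: sum_negf flip: sum_distrib_right)
  have nonneg: "0 \<le> M s - ereal B" for s
    using B[of s] fin[of s] by (cases "M s") auto
  have "enn2ereal (\<Sum>y\<in>UNIV. e2ennreal (M (t @ [y]) - ereal B) * ennreal (pmf (p t) y))
      = (\<Sum>y\<in>UNIV. ereal (pmf (p t) y) * (M (t @ [y]) - ereal B))"
    using nonneg by (simp add: sum_enn2ereal[symmetric] times_ennreal.rep_eq enn2ereal_e2ennreal mult.commute)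
  also have "\<dots> = (\<Sum>y\<in>UNIV. ereal (pmf (p t) y) * M (t @ [y])) + ereal (- B)"
    unfolding split sum.distrib sum_ereal one ..
  also have "\<dots> \<le> M t - ereal B"
    using step by (simp add: minus_ereal_def add_right_mono)
  finally show ?thesis
    using nonneg[of t] by (simp add: less_eq_ennreal.rep_eq enn2ereal_e2ennreal)
qed

text \<open>The expected value of \<open>M\<close> along the path cannot increase after \<open>s\<close>, and Fatou's lemma passes this
  to the limit inferior.\<close>

theorem expectation_le_supermartingale:
  fixes p :: "'x::finite process"
  assumes p: "p \<in> compatible_processes \<T>" and s: "s \<noteq> []"
    and M: "supermartingale Q \<T> M"
    and f: "f \<in> borel_measurable (path_measure p s)" and bounded: "\<And>\<omega>. \<bar>f \<omega>\<bar> \<le> C"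
    and le: "\<And>\<omega>. \<omega> \<in> cylinder s \<Longrightarrow> ereal (f \<omega>) \<le> liminf (\<lambda>m. M (prefix_of \<omega> (Suc m)))"
  shows "ereal (expectation_given p f s) \<le> M s"
proof -
  define \<mu> where "\<mu> = path_measure p s"
  have \<mu>: "is_path_measure p s \<mu>"
    unfolding \<mu>_def by (rule path_measure)
  then interpret \<mu>: prob_space \<mu>
    by (simp add: is_path_measure_def)
  have sets_\<mu>: "sets \<mu> = sets path_space" and cyl: "measure \<mu> (cylinder s) = 1"
    using \<mu> by (simp_all add: is_path_measure_def)
  obtain B0 where B0: "\<And>t. ereal B0 \<le> M t"
    using M unfolding supermartingale_def by blast
  \<comment> \<open>One constant below both \<open>M\<close> and \<open>f\<close>, so that the same shift makes both non-negative.\<close>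
  define B where "B = min B0 (- C)"
  have B: "ereal B \<le> M t" for t
    by (rule order_trans[OF _ B0]) (simp add: B_def)
  have Bf: "B \<le> f \<omega>" for \<omega>
    using bounded[of \<omega>] by (auto simp: B_def)
  define \<phi> where "\<phi> z = e2ennreal (z - ereal B)" for z
  define N where "N t = \<phi> (M t)" for t
  have cont: "continuous_on UNIV \<phi>"
  proof -
    have "continuous_on UNIV (\<lambda>z. z + ereal (- B))"
      by (auto simp: continuous_on_def)
    then have "continuous_on UNIV (\<lambda>z. e2ennreal (z + ereal (- B)))"
      by (rule continuous_on_compose2[OF continuous_on_e2ennreal]) auto
    then show ?thesis by (simp add: \<phi>_def[abs_def] minus_ereal_def)
  qed
  have mono: "mono \<phi>"
    by (auto simp: mono_def \<phi>_def intro!: e2ennreal_mono ereal_minus_mono)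
  have AE_cyl: "AE \<omega> in \<mu>. \<omega> \<in> cylinder s"
    using cyl sets_\<mu> by (subst \<mu>.AE_in_set_eq_1) auto
  have expect: "(\<integral>\<^sup>+\<omega>. N (prefix_of \<omega> m) \<partial>\<mu>) \<le> N s" if "length s \<le> m" for m
    using that
  proof (induction m rule: dec_induct)
    case base
    have "(\<integral>\<^sup>+\<omega>. N (prefix_of \<omega> (length s)) \<partial>\<mu>) = (\<integral>\<^sup>+\<omega>. N s \<partial>\<mu>)"
      by (rule nn_integral_cong_AE) (use AE_cyl in eventually_elim, simp add: cylinder_def)
    then show ?case by (simp add: \<mu>.emeasure_space_1)
  next
    case (step m)
    have "(\<integral>\<^sup>+\<omega>. N (prefix_of \<omega> (Suc m)) \<partial>\<mu>)
        = (\<Sum>t | length t = m. \<Sum>y\<in>UNIV. N (t @ [y]) * emeasure \<mu> (cylinder (t @ [y])))"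
      by (simp add: nn_integral_prefix_of(2)[OF sets_\<mu>] sum_strings_Suc)
    also have "\<dots> \<le> (\<Sum>t | length t = m. N t * emeasure \<mu> (cylinder t))"
    proof (rule sum_mono)
      fix t :: "'x list" assume "t \<in> {t. length t = m}"
      then have len: "length s \<le> length t" using step by simp
      then have t: "t \<noteq> []" using s by auto
      have "emeasure \<mu> (cylinder (t @ [y])) = ennreal (pmf (p t) y) * emeasure \<mu> (cylinder t)" for y
        using \<mu> len unfolding is_path_measure_def
        by (simp add: \<mu>.emeasure_eq_measure ennreal_mult mult.commute)
      then have "(\<Sum>y\<in>UNIV. N (t @ [y]) * emeasure \<mu> (cylinder (t @ [y])))
          = (\<Sum>y\<in>UNIV. N (t @ [y]) * ennreal (pmf (p t) y)) * emeasure \<mu> (cylinder t)"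
        by (simp add: sum_distrib_right mult.assoc)
      also have "\<dots> \<le> N t * emeasure \<mu> (cylinder t)"
        unfolding N_def \<phi>_def
        by (intro mult_right_mono supermartingale_shift_step[OF M B p t]) auto
      finally show "(\<Sum>y\<in>UNIV. N (t @ [y]) * emeasure \<mu> (cylinder (t @ [y])))
          \<le> N t * emeasure \<mu> (cylinder t)" .
    qed
    also have "\<dots> = (\<integral>\<^sup>+\<omega>. N (prefix_of \<omega> m) \<partial>\<mu>)"
      by (simp add: nn_integral_prefix_of(2)[OF sets_\<mu>])
    also have "\<dots> \<le> N s" by (rule step.IH)
    finally show ?case .
  qed
  have f\<mu>: "integrable \<mu> f"
    using f bounded by (intro \<mu>.integrable_const_bound[where B = C]) (auto simp: \<mu>_def)
  have int: "(\<integral>\<omega>. f \<omega> - B \<partial>\<mu>) = expectation_given p f s - B"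
    using f\<mu> by (simp add: expectation_given_def \<mu>_def[symmetric] \<mu>.prob_space)
  have "ennreal (expectation_given p f s - B) = (\<integral>\<^sup>+\<omega>. ennreal (f \<omega> - B) \<partial>\<mu>)"
    using f\<mu> Bf by (subst nn_integral_eq_integral) (auto simp: int)
  also have "\<dots> \<le> (\<integral>\<^sup>+\<omega>. liminf (\<lambda>m. N (prefix_of \<omega> (Suc m))) \<partial>\<mu>)"
  proof (rule nn_integral_mono_AE, use AE_cyl in eventually_elim)
    fix \<omega> assume "\<omega> \<in> cylinder s"
    then have "\<phi> (ereal (f \<omega>)) \<le> \<phi> (liminf (\<lambda>m. M (prefix_of \<omega> (Suc m))))"
      by (intro monoD[OF mono] le)
    also have "\<dots> = liminf (\<lambda>m. N (prefix_of \<omega> (Suc m)))"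
      unfolding N_def by (rule Liminf_compose_continuous_mono[OF cont mono, symmetric]) simp
    finally show "ennreal (f \<omega> - B) \<le> liminf (\<lambda>m. N (prefix_of \<omega> (Suc m)))"
      by (simp add: \<phi>_def)
  qed
  also have "\<dots> \<le> liminf (\<lambda>m. \<integral>\<^sup>+\<omega>. N (prefix_of \<omega> (Suc m)) \<partial>\<mu>)"
    by (rule nn_integral_liminf) (rule nn_integral_prefix_of(1)[OF sets_\<mu>])
  also have "\<dots> \<le> liminf (\<lambda>m. N s)"
    by (rule Liminf_mono, rule eventually_sequentiallyI[of "length s"]) (rule expect, simp)
  also have "\<dots> = N s" by (simp add: Liminf_const)
  finally have "e2ennreal (ereal (expectation_given p f s - B)) \<le> e2ennreal (M s - ereal B)"
    by (simp add: N_def \<phi>_def)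
  moreover have "B \<le> expectation_given p f s"
  proof -
    have "(\<integral>\<omega>. B \<partial>\<mu>) \<le> (\<integral>\<omega>. f \<omega> \<partial>\<mu>)"
      by (rule integral_mono) (use f\<mu> Bf in auto)
    then show ?thesis
      by (simp add: expectation_given_def \<mu>_def \<mu>.prob_space[unfolded \<mu>_def])
  qed
  moreover have "0 \<le> M s - ereal B"
    using B[of s] by (cases "M s") auto
  ultimately have "ereal (expectation_given p f s - B) \<le> M s - ereal B"
    by (simp add: less_eq_ennreal.rep_eq enn2ereal_e2ennreal del: e2ennreal_ereal)
  then have "ereal (expectation_given p f s - B) + ereal B \<le> (M s - ereal B) + ereal B"
    by (rule add_right_mono)
  also have "(M s - ereal B) + ereal B = M s"
    by (cases "M s") simp_all
  finally show ?thesis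
    by simp
qed

corollary expectation_le_upper_V:
  fixes p :: "'x::finite process"
  assumes "p \<in> compatible_processes \<T>" and "s \<noteq> []"
    and "f \<in> borel_measurable (path_measure p s)" and "\<And>\<omega>. \<bar>f \<omega>\<bar> \<le> C"
  shows "ereal (expectation_given p f s) \<le> upper_V Q \<T> (\<lambda>\<omega>. ereal (f \<omega>)) s"
  unfolding upper_V_def
proof (rule Inf_greatest)
  fix z assume "z \<in> {M s | M. supermartingale Q \<T> M \<and>
    (\<forall>\<omega>\<in>cylinder s. ereal (f \<omega>) \<le> liminf (\<lambda>m. M (prefix_of \<omega> (Suc m))))}"
  then obtain M where z: "z = M s" and M: "supermartingale Q \<T> M"
    and le: "\<forall>\<omega>\<in>cylinder s. ereal (f \<omega>) \<le> liminf (\<lambda>m. M (prefix_of \<omega> (Suc m)))"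
    by blast
  show "ereal (expectation_given p f s) \<le> z"
    unfolding z
  proof (rule expectation_le_supermartingale[OF assms(1,2) M assms(3)])
    show "\<bar>f \<omega>\<bar> \<le> C" for \<omega> by (rule assms(4))
    show "ereal (f \<omega>) \<le> liminf (\<lambda>m. M (prefix_of \<omega> (Suc m)))" if "\<omega> \<in> cylinder s" for \<omega>
      using le that by blast
  qed
qed

section \<open>Supermartingales stopped at the first hitting time\<close>

definition one_step :: "real ^ 'x ^ 'x \<Rightarrow> ('x::finite \<Rightarrow> real) \<Rightarrow> 'x \<Rightarrow> real" where
  "one_step T f x = (\<Sum>y\<in>UNIV. T $ x $ y * f y)"

text \<open>The position in \<open>s\<close> of the first state in \<open>A\<close>, or the last position if there is none.  Searching
  only \<^term>\<open>butlast s\<close> merges the two cases, since a first hit at the last position gives that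
  position in either case.\<close>

definition stop_index :: "'x set \<Rightarrow> 'x list \<Rightarrow> nat" where
  "stop_index A s = length (takeWhile (\<lambda>y. y \<notin> A) (butlast s))"

lemma stop_index_not_hit: "(\<And>y. y \<in> set (butlast s) \<Longrightarrow> y \<notin> A) \<Longrightarrow> stop_index A s = length s - 1"
  by (simp add: stop_index_def takeWhile_eq_all_conv[THEN iffD2])

lemma stop_index_hit:
  assumes "k < length s" "s ! k \<in> A" "\<And>i. i < k \<Longrightarrow> s ! i \<notin> A"
  shows "stop_index A s = k"
proof -
  have nth: "butlast s ! i = s ! i" if "i < k" for i
    using assms(1) that by (intro nth_butlast) simp
  have "length (takeWhile (\<lambda>y. y \<notin> A) (butlast s)) = k"
  proof (cases "k = length s - 1")
    case True
    then have "\<forall>y\<in>set (butlast s). y \<notin> A"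
      using assms(3) nth by (fastforce simp: in_set_conv_nth)
    then have "takeWhile (\<lambda>y. y \<notin> A) (butlast s) = butlast s"
      by (simp add: takeWhile_eq_all_conv)
    then have "length (takeWhile (\<lambda>y. y \<notin> A) (butlast s)) = length (butlast s)"
      by (rule arg_cong)
    then show ?thesis using True by (simp del: length_takeWhile_le)
  next
    case False
    then have k: "k < length (butlast s)" using assms(1) by simp
    then have "takeWhile (\<lambda>y. y \<notin> A) (butlast s) = take k (butlast s)"
      using assms(2,3) nth by (intro takeWhile_eq_take_P_nth) (auto simp: nth_butlast)
    then show ?thesis using k by simp
  qed
  then show ?thesis by (simp add: stop_index_def)
qed

text \<open>The value \<open>\<infinity>\<close> at the empty string makes the supermartingale inequality there trivial.\<close>

definition stopped :: "'x set \<Rightarrow> (nat \<Rightarrow> 'x \<Rightarrow> real) \<Rightarrow> 'x list \<Rightarrow> ereal" where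
  "stopped A g s = (if s = [] then \<infinity> else ereal (g (stop_index A s) (s ! stop_index A s)))"

lemma apply_matrix_ereal: "apply_matrix T (\<lambda>y. ereal (f y)) x = ereal (one_step T f x)"
  by (simp add: apply_matrix_def one_step_def)

lemma one_step_const: "transition_matrix T \<Longrightarrow> one_step T (\<lambda>_. c) x = c"
  by (simp add: one_step_def transition_matrix_def flip: sum_distrib_right)

text \<open>After a hit the process is frozen and averaging a constant changes nothing; before a hit the stop
  index is the time of the last state and the inequality is the assumed one-step inequality.\<close>

lemma supermartingale_stopped:
  assumes T: "\<And>T. T \<in> \<T> \<Longrightarrow> transition_matrix T"
    and bound: "\<And>n y. B \<le> g n y"
    and step: "\<And>T n x. T \<in> \<T> \<Longrightarrow> x \<notin> A \<Longrightarrow> one_step T (g (Suc n)) x \<le> g n x"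
  shows "supermartingale Q \<T> (stopped A g)"
  unfolding supermartingale_def
proof (intro conjI allI exI[of _ B])
  fix s
  show "ereal B \<le> stopped A g s"
    using bound by (simp add: stopped_def)
  show "local_upper Q \<T> s (\<lambda>y. stopped A g (s @ [y])) \<le> stopped A g s"
  proof (cases "s = []")
    case False
    let ?k = "stop_index A s"
    have k: "stop_index A (s @ [y]) = length (takeWhile (\<lambda>y. y \<notin> A) s)" for y
      by (simp add: stop_index_def)
    have "apply_matrix T (\<lambda>y. stopped A g (s @ [y])) (last s) \<le> stopped A g s" if "T \<in> \<T>" for T
    proof (cases "\<exists>y\<in>set s. y \<in> A")
      case True
      define j where "j = length (takeWhile (\<lambda>y. y \<notin> A) s)"
      have j: "j < length s"
        using True nth_length_takeWhile[of "\<lambda>y. y \<notin> A" s] length_takeWhile_le[of "\<lambda>y. y \<notin> A" s]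
          takeWhile_eq_all_conv[of "\<lambda>y. y \<notin> A" s]
        unfolding j_def by (metis le_neq_implies_less takeWhile_eq_take take_all_iff)
      have "stop_index A s = j"
      proof (rule stop_index_hit[OF j])
        show "s ! j \<in> A" using nth_length_takeWhile[of "\<lambda>y. y \<notin> A" s] j by (simp add: j_def)
        show "s ! i \<notin> A" if "i < j" for i
          using that nth_mem[of i "takeWhile (\<lambda>y. y \<notin> A) s"] unfolding j_def
          by (metis set_takeWhileD takeWhile_nth)
      qed
      then have "stopped A g (s @ [y]) = ereal (g ?k (s ! ?k))" for y
        using j k[of y] by (simp add: stopped_def j_def[symmetric] nth_append)
      then show ?thesis
        using False one_step_const[OF T[OF that]] by (simp add: apply_matrix_ereal stopped_def)
    next
      case nohit: False
      have k': "?k = length s - 1"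
        using nohit by (intro stop_index_not_hit) (auto dest: in_set_butlastD)
      have "takeWhile (\<lambda>y. y \<notin> A) s = s"
        using nohit by (simp add: takeWhile_eq_all_conv)
      then have "stop_index A (s @ [y]) = length s" for y
        unfolding k by (rule arg_cong)
      then have ext: "stopped A g (s @ [y]) = ereal (g (Suc ?k) y)" for y
        using False k' by (simp add: stopped_def)
      have "one_step T (g (Suc ?k)) (last s) \<le> g ?k (last s)"
        using step[OF that] nohit False by auto
      then show ?thesis
        using False k' by (simp add: ext apply_matrix_ereal) (simp add: stopped_def last_conv_nth)
    qed
    then show ?thesis
      using False by (simp add: local_upper_def upper_transition_def SUP_le_iff)
  qed (simp add: stopped_def)
qed

text \<open>With \<open>c = 1\<close> this bounds the upper expectation of hitting, with \<open>c = -1\<close> minus the lower one.  The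
  sequence \<open>b\<close> expresses that \<open>g\<close> is asymptotically non-negative along paths that miss \<open>A\<close>.\<close>

theorem upper_V_hits_le:
  assumes T: "\<And>T. T \<in> \<T> \<Longrightarrow> transition_matrix T"
    and bound: "\<And>n y. B \<le> g n y"
    and step: "\<And>T n x. T \<in> \<T> \<Longrightarrow> x \<notin> A \<Longrightarrow> one_step T (g (Suc n)) x \<le> g n x"
    and hit: "\<And>n y. y \<in> A \<Longrightarrow> c \<le> g n y"
    and tail: "\<And>n y. y \<notin> A \<Longrightarrow> b n \<le> g n y" and b: "b \<longlonglongrightarrow> 0"
  shows "upper_V Q \<T> (\<lambda>\<omega>. ereal (c * hits A \<omega>)) [x] \<le> ereal (g 0 x)"
proof -
  let ?M = "stopped A g"
  have "ereal (c * hits A \<omega>) \<le> liminf (\<lambda>m. ?M (prefix_of \<omega> (Suc m)))" for \<omega>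
  proof (cases "\<exists>t. \<omega> t \<in> A")
    case True
    define k where "k = (LEAST t. \<omega> t \<in> A)"
    have k: "\<omega> k \<in> A" "\<And>i. i < k \<Longrightarrow> \<omega> i \<notin> A"
      unfolding k_def using True by (auto intro: LeastI_ex dest: not_less_Least)
    have "ereal c \<le> ?M (prefix_of \<omega> (Suc m))" if "k \<le> m" for m
    proof -
      have "stop_index A (prefix_of \<omega> (Suc m)) = k"
        using k that by (intro stop_index_hit) (auto simp: prefix_of_def simp del: upt_Suc)
      then show ?thesis
        using hit[OF k(1)] that by (simp add: stopped_def prefix_of_def del: upt_Suc)
    qed
    then show ?thesis
      using True by (intro Liminf_bounded eventually_sequentiallyI[of k]) (auto simp: hits_def)
  next
    case False
    have "ereal (b m) \<le> ?M (prefix_of \<omega> (Suc m))" for m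
    proof -
      have "stop_index A (prefix_of \<omega> (Suc m)) = m"
        using False by (subst stop_index_not_hit) (auto simp: prefix_of_def dest!: in_set_butlastD simp del: upt_Suc)
      then show ?thesis
        using tail[of "\<omega> m" m] False by (simp add: stopped_def prefix_of_def del: upt_Suc)
    qed
    then have "liminf (\<lambda>m. ereal (b m)) \<le> liminf (\<lambda>m. ?M (prefix_of \<omega> (Suc m)))"
      by (intro Liminf_mono) simp
    moreover have "liminf (\<lambda>m. ereal (b m)) = ereal 0"
      using b by (intro lim_imp_Liminf) auto
    ultimately show ?thesis using False by (simp add: hits_def)
  qed
  then have "upper_V Q \<T> (\<lambda>\<omega>. ereal (c * hits A \<omega>)) [x] \<le> ?M [x]"
    unfolding upper_V_def
    by (intro Inf_lower CollectI exI[of _ ?M] conjI refl ballI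
        supermartingale_stopped[where B = B] T bound step)
  then show ?thesis by (simp add: stopped_def stop_index_def)
qed

text \<open>A homogeneous chain is compatible with the family consisting of its own matrix, so the bound on
  the game-theoretic expectation is also one on the hitting probability of a single chain.\<close>

corollary expectation_hits_le:
  assumes p: "p \<in> homogeneous_chains {T}" and T: "transition_matrix T"
    and bound: "\<And>n y. B \<le> g n y"
    and step: "\<And>n x. x \<notin> A \<Longrightarrow> one_step T (g (Suc n)) x \<le> g n x"
    and hit: "\<And>n y. y \<in> A \<Longrightarrow> c \<le> g n y"
    and tail: "\<And>n y. y \<notin> A \<Longrightarrow> b n \<le> g n y" and b: "b \<longlonglongrightarrow> 0"
  shows "c * expectation_given p (hits A) [x] \<le> g 0 x"
proof -
  have p': "p \<in> compatible_processes {T}"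
    using p by (auto simp: homogeneous_chains_def compatible_processes_def)
  \<comment> \<open>A placeholder initial operator: conditioning starts at \<open>[x]\<close>, after the empty string.\<close>
  have "ereal (expectation_given p (\<lambda>\<omega>. c * hits A \<omega>) [x])
      \<le> upper_V (\<lambda>_. \<infinity>) {T} (\<lambda>\<omega>. ereal (c * hits A \<omega>)) [x]"
  proof (rule expectation_le_upper_V[OF p'])
    show "(\<lambda>\<omega>. c * hits A \<omega>) \<in> borel_measurable (path_measure p [x])"
      by (intro borel_measurable_times borel_measurable_const hits_measurable)
    show "\<bar>c * hits A \<omega>\<bar> \<le> \<bar>c\<bar>" for \<omega>
      by (simp add: hits_def)
  qed simp
  also have "\<dots> \<le> ereal (g 0 x)"
    by (rule upper_V_hits_le[where B = B and b = b]) (use assms in auto)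
  finally show ?thesis
    by (simp add: expectation_given_def)
qed

lemma homogeneous_chains_nonempty:
  assumes T: "transition_matrix T"
  shows "homogeneous_chains {T} \<noteq> {}"
proof -
  have "pmf (embed_pmf (\<lambda>y. T $ x $ y)) y = T $ x $ y" for x y
  proof (rule pmf_embed_pmf)
    show "0 \<le> T $ x $ y" for y
      using T by (simp add: transition_matrix_def)
    show "(\<integral>\<^sup>+y. ennreal (T $ x $ y) \<partial>count_space UNIV) = 1"
      using T by (simp add: nn_integral_count_space_finite transition_matrix_def sum_ennreal)
  qed
  then have "(\<lambda>s. embed_pmf (\<lambda>y. T $ last s $ y)) \<in> homogeneous_chains {T}"
    by (simp add: homogeneous_chains_def)
  then show ?thesis by blast
qed

section \<open>Optimal transition matrices\<close>

lemma compact_transition_matrices: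
  fixes \<T> :: "(real ^ 'x ^ 'x) set"
  assumes "closed \<T>" and T: "\<And>T. T \<in> \<T> \<Longrightarrow> transition_matrix T"
  shows "compact \<T>"
proof -
  have "norm T \<le> (\<Sum>x\<in>(UNIV :: 'x set). 1)" if "T \<in> \<T>" for T :: "real ^ 'x ^ 'x"
  proof -
    have "norm T \<le> (\<Sum>x\<in>UNIV. norm (T $ x))"
      unfolding norm_vec_def by (rule L2_set_le_sum) simp
    also have "\<dots> \<le> (\<Sum>x\<in>(UNIV :: 'x set). 1)"
    proof (rule sum_mono)
      fix x
      have "norm (T $ x) \<le> (\<Sum>y\<in>UNIV. \<bar>T $ x $ y\<bar>)"
        by (rule norm_le_l1_cart)
      also have "\<dots> = 1"
        using T[OF that] by (simp add: transition_matrix_def)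
      finally show "norm (T $ x) \<le> 1" .
    qed
    finally show ?thesis .
  qed
  then have "bounded \<T>"
    unfolding bounded_iff by blast
  then show ?thesis
    using assms(1) by (simp add: compact_eq_bounded_closed)
qed

lemma one_step_mono:
  "transition_matrix T \<Longrightarrow> (\<And>y. f y \<le> g y) \<Longrightarrow> one_step T f x \<le> one_step T g x"
  unfolding one_step_def by (intro sum_mono mult_left_mono) (auto simp: transition_matrix_def)

lemma one_step_cmult: "one_step T (\<lambda>y. c * f y) x = c * one_step T f x"
  by (simp add: one_step_def sum_distrib_left mult_ac)

lemma one_step_minus: "one_step T (\<lambda>y. - f y) x = - one_step T f x"
  by (simp add: one_step_def sum_negf)

lemma tendsto_one_step:
  "(\<And>y. (\<lambda>n. f n y) \<longlonglongrightarrow> g y) \<Longrightarrow> (\<lambda>n. one_step T (f n) x) \<longlonglongrightarrow> one_step T g x"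
  unfolding one_step_def by (intro tendsto_intros)

locale transition_family =
  fixes \<T> :: "(real ^ 'x::finite ^ 'x) set"
  assumes nonempty: "\<T> \<noteq> {}"
    and transition: "T \<in> \<T> \<Longrightarrow> transition_matrix T"
    and closed: "closed \<T>"
    and rows: "separately_specified_rows \<T>"
begin

text \<open>Compactness gives an optimal matrix for each row, and these rows are assembled into one matrix.\<close>

lemma greedy_matrix_exists: "\<exists>T\<in>\<T>. \<forall>S\<in>\<T>. \<forall>x. one_step S f x \<le> one_step T f x"
proof -
  have "\<exists>T\<in>\<T>. \<forall>S\<in>\<T>. one_step S f x \<le> one_step T f x" for x
  proof (rule continuous_attains_sup)
    show "compact \<T>"
      by (rule compact_transition_matrices[OF closed transition])
    show "continuous_on \<T> (\<lambda>T. one_step T f x)"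
      unfolding one_step_def by (intro continuous_intros)
  qed (rule nonempty)
  then obtain R where R: "\<And>x. R x \<in> \<T>" "\<And>x S. S \<in> \<T> \<Longrightarrow> one_step S f x \<le> one_step (R x) f x"
    by metis
  obtain T where T: "T \<in> \<T>" "\<And>x. T $ x = R x $ x"
    using rows R(1) unfolding separately_specified_rows_def by metis
  have "one_step T f x = one_step (R x) f x" for x
    by (simp add: one_step_def T(2))
  then show ?thesis using R(2) T(1) by (metis (no_types))
qed

definition greedy_matrix :: "('x \<Rightarrow> real) \<Rightarrow> real ^ 'x ^ 'x" where
  "greedy_matrix f = (SOME T. T \<in> \<T> \<and> (\<forall>S\<in>\<T>. \<forall>x. one_step S f x \<le> one_step T f x))"

definition max_step :: "('x \<Rightarrow> real) \<Rightarrow> 'x \<Rightarrow> real" where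
  "max_step f = one_step (greedy_matrix f) f"

definition min_step :: "('x \<Rightarrow> real) \<Rightarrow> 'x \<Rightarrow> real" where
  "min_step f x = - max_step (\<lambda>y. - f y) x"

lemma greedy_matrix_in: "greedy_matrix f \<in> \<T>"
  and one_step_le_max_step: "S \<in> \<T> \<Longrightarrow> one_step S f x \<le> max_step f x"
proof -
  have "greedy_matrix f \<in> \<T> \<and> (\<forall>S\<in>\<T>. \<forall>x. one_step S f x \<le> one_step (greedy_matrix f) f x)"
    unfolding greedy_matrix_def by (rule someI_ex) (use greedy_matrix_exists in blast)
  then show "greedy_matrix f \<in> \<T>" "S \<in> \<T> \<Longrightarrow> one_step S f x \<le> max_step f x"
    by (auto simp: max_step_def)
qed

lemma min_step_eq: "min_step f = one_step (greedy_matrix (\<lambda>y. - f y)) f"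
  by (rule ext) (simp add: min_step_def max_step_def one_step_minus)

lemma min_step_le_one_step: "S \<in> \<T> \<Longrightarrow> min_step f x \<le> one_step S f x"
  using one_step_le_max_step[of S "\<lambda>y. - f y" x] by (simp add: min_step_def one_step_minus)

lemma max_step_mono: "(\<And>y. f y \<le> g y) \<Longrightarrow> max_step f x \<le> max_step g x"
  unfolding max_step_def[of f]
  by (rule order_trans[OF one_step_mono one_step_le_max_step])
    (auto intro: transition greedy_matrix_in)

lemma min_step_mono: "(\<And>y. f y \<le> g y) \<Longrightarrow> min_step f x \<le> min_step g x"
  by (simp add: min_step_def max_step_mono)

lemma max_step_const: "max_step (\<lambda>_. c) x = c" and min_step_const: "min_step (\<lambda>_. c) x = c"
  by (simp_all add: min_step_def max_step_def one_step_const transition greedy_matrix_in)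

end


section \<open>Convergence of iterated hitting values\<close>

text \<open>The value of \<open>A\<close> being hit by one of the first \<open>n\<close> states.  Starting from \<open>0\<close> rather than from
  the indicator of \<open>A\<close> lets the horizon \<open>0\<close> count no state at all, so the initial function needs no
  case distinction.\<close>

fun hitting_iterate :: "(('x \<Rightarrow> real) \<Rightarrow> 'x \<Rightarrow> real) \<Rightarrow> 'x set \<Rightarrow> nat \<Rightarrow> 'x \<Rightarrow> real" where
  "hitting_iterate L A 0 x = 0"
| "hitting_iterate L A (Suc n) x = (if x \<in> A then 1 else L (hitting_iterate L A n) x)"

definition hitting_limit :: "(('x \<Rightarrow> real) \<Rightarrow> 'x \<Rightarrow> real) \<Rightarrow> 'x set \<Rightarrow> 'x \<Rightarrow> real" where
  "hitting_limit L A x = lim (\<lambda>n. hitting_iterate L A n x)"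

locale monotone_averaging =
  fixes L :: "('x \<Rightarrow> real) \<Rightarrow> 'x \<Rightarrow> real"
  assumes mono: "(\<And>y. f y \<le> g y) \<Longrightarrow> L f x \<le> L g x"
    and zero: "0 \<le> L (\<lambda>_. 0) x"
    and one: "L (\<lambda>_. 1) x \<le> 1"
begin

lemma iterate_bounds: "0 \<le> hitting_iterate L A n x" "hitting_iterate L A n x \<le> 1"
proof -
  have "0 \<le> hitting_iterate L A n x \<and> hitting_iterate L A n x \<le> 1"
  proof (induction n arbitrary: x)
    case (Suc n)
    have "0 \<le> L (hitting_iterate L A n) x"
      using Suc by (intro order_trans[OF zero mono]) auto
    moreover have "L (hitting_iterate L A n) x \<le> 1"
      using Suc by (intro order_trans[OF mono one]) auto
    ultimately show ?case by simp
  qed simp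
  then show "0 \<le> hitting_iterate L A n x" "hitting_iterate L A n x \<le> 1" by auto
qed

lemma iterate_Suc_ge: "hitting_iterate L A n x \<le> hitting_iterate L A (Suc n) x"
proof (induction n arbitrary: x)
  case 0
  show ?case using iterate_bounds(1)[of A "Suc 0" x] by simp
next
  case (Suc n)
  then show ?case by (auto intro: mono)
qed

lemma iterate_incseq: "incseq (\<lambda>n. hitting_iterate L A n x)"
  by (intro incseq_SucI iterate_Suc_ge)

lemma iterate_tendsto: "(\<lambda>n. hitting_iterate L A n x) \<longlonglongrightarrow> hitting_limit L A x"
proof -
  have "convergent (\<lambda>n. hitting_iterate L A n x)"
  proof (rule Bseq_monoseq_convergent)
    show "Bseq (\<lambda>n. hitting_iterate L A n x)"
      using iterate_bounds[of A _ x] by (intro BseqI'[of _ 1]) simp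
    show "monoseq (\<lambda>n. hitting_iterate L A n x)"
      using iterate_incseq by (simp add: incseq_imp_monoseq)
  qed
  then show ?thesis
    unfolding hitting_limit_def by (simp add: convergent_LIMSEQ_iff)
qed

lemma iterate_le_limit: "hitting_iterate L A n x \<le> hitting_limit L A x"
  by (rule incseq_le[OF iterate_incseq iterate_tendsto])

lemma limit_bounds: "0 \<le> hitting_limit L A x" "hitting_limit L A x \<le> 1"
  using order_trans[OF iterate_bounds(1) iterate_le_limit]
    LIMSEQ_le_const2[OF iterate_tendsto, of A x 1] iterate_bounds(2) by auto

lemma limit_hit: "x \<in> A \<Longrightarrow> hitting_limit L A x = 1"
  using iterate_le_limit[of A "Suc 0" x] limit_bounds(2)[of A x] by simp

end


section \<open>The upper hitting probability\<close>

context transition_family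
begin

lemma discounted_averaging:
  assumes "0 \<le> \<delta>" "\<delta> \<le> 1"
  shows "monotone_averaging (\<lambda>f x. \<delta> * max_step f x)"
  by standard (use assms in \<open>auto intro!: mult_left_mono max_step_mono simp: max_step_const\<close>)

lemma max_averaging: "monotone_averaging max_step"
  using discounted_averaging[of 1] by simp

text \<open>The inequality holds also on \<open>A\<close>, where the limit has its largest possible value \<open>1\<close>.\<close>

lemma one_step_max_limit_le:
  assumes "T \<in> \<T>"
  shows "one_step T (hitting_limit max_step A) x \<le> hitting_limit max_step A x"
proof -
  interpret monotone_averaging max_step by (rule max_averaging)
  show ?thesis
  proof (cases "x \<in> A")
    case True
    have "one_step T (hitting_limit max_step A) x \<le> one_step T (\<lambda>_. 1) x"
      by (intro one_step_mono transition assms limit_bounds)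
    then show ?thesis
      using True by (simp add: limit_hit one_step_const transition assms)
  next
    case False
    show ?thesis
    proof (rule LIMSEQ_le_const2)
      show "(\<lambda>n. one_step T (hitting_iterate max_step A n) x) \<longlonglongrightarrow> one_step T (hitting_limit max_step A) x"
        by (rule tendsto_one_step) (rule iterate_tendsto)
      have "one_step T (hitting_iterate max_step A n) x \<le> hitting_limit max_step A x" for n
        using one_step_le_max_step[OF assms, of "hitting_iterate max_step A n" x]
          iterate_le_limit[of A "Suc n" x] False by simp
      then show "\<exists>N. \<forall>n\<ge>N. one_step T (hitting_iterate max_step A n) x \<le> hitting_limit max_step A x"
        by blast
    qed
  qed
qed

lemma upper_V_le_max_limit:
  "upper_V Q \<T> (\<lambda>\<omega>. ereal (hits A \<omega>)) [x] \<le> ereal (hitting_limit max_step A x)"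
proof -
  interpret monotone_averaging max_step by (rule max_averaging)
  have "upper_V Q \<T> (\<lambda>\<omega>. ereal (1 * hits A \<omega>)) [x] \<le> ereal (hitting_limit max_step A x)"
    by (rule upper_V_hits_le[where g = "\<lambda>_. hitting_limit max_step A" and B = 0 and b = "\<lambda>_. 0"])
      (simp_all add: transition limit_bounds one_step_max_limit_le limit_hit)
  then show ?thesis by simp
qed

text \<open>A hit within horizon \<open>n\<close> is discounted fewer than \<open>n\<close> times.\<close>

lemma power_mult_iterate_le:
  assumes "0 \<le> \<delta>" "\<delta> \<le> 1"
  shows "\<delta> ^ n * hitting_iterate max_step A n x
    \<le> hitting_iterate (\<lambda>f x. \<delta> * max_step f x) A n x"
proof (induction n arbitrary: x)
  case (Suc n)
  let ?u = "hitting_iterate max_step A n"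
  let ?v = "hitting_iterate (\<lambda>f x. \<delta> * max_step f x) A n"
  have "\<delta> ^ n * max_step ?u x = one_step (greedy_matrix ?u) (\<lambda>y. \<delta> ^ n * ?u y) x"
    by (simp add: max_step_def one_step_cmult)
  also have "\<dots> \<le> one_step (greedy_matrix ?u) ?v x"
    by (intro one_step_mono transition greedy_matrix_in Suc.IH)
  also have "\<dots> \<le> max_step ?v x"
    by (rule one_step_le_max_step[OF greedy_matrix_in])
  finally have "\<delta> * (\<delta> ^ n * max_step ?u x) \<le> \<delta> * max_step ?v x"
    using assms by (intro mult_left_mono) auto
  moreover have "\<delta> ^ Suc n \<le> 1"
    using assms by (intro power_le_one) auto
  ultimately show ?case by (simp add: mult_ac)
qed simp

text \<open>Let \<open>v\<close> be the discounted limit and \<open>T\<close> a greedy matrix for it, so that \<open>v \<le> \<delta> * T v\<close> outside \<open>A\<close>.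
  Then \<open>- (\<delta> ^ n * v)\<close> satisfies the one-step inequality for \<open>T\<close>.  It is at least \<open>-1\<close> on \<open>A\<close>, and it
  vanishes in the limit otherwise: here the strict inequality \<open>\<delta> < 1\<close> is essential.\<close>

lemma homogeneous_chain_ge_discounted_limit:
  assumes \<delta>: "0 \<le> \<delta>" "\<delta> < 1"
  shows "\<exists>p\<in>homogeneous_chains \<T>. \<forall>x.
    hitting_limit (\<lambda>f x. \<delta> * max_step f x) A x \<le> expectation_given p (hits A) [x]"
proof -
  interpret monotone_averaging "\<lambda>f x. \<delta> * max_step f x"
    using \<delta> by (intro discounted_averaging) auto
  let ?v = "hitting_limit (\<lambda>f x. \<delta> * max_step f x) A"
  define T where "T = greedy_matrix ?v"
  have T: "T \<in> \<T>"
    unfolding T_def by (rule greedy_matrix_in)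
  have le: "?v x \<le> \<delta> * one_step T ?v x" if "x \<notin> A" for x
  proof (rule LIMSEQ_le_const2[OF iterate_tendsto[THEN LIMSEQ_Suc]])
    have "hitting_iterate (\<lambda>f x. \<delta> * max_step f x) A (Suc n) x \<le> \<delta> * one_step T ?v x" for n
      unfolding T_def max_step_def[symmetric]
      using that \<delta> by (auto intro!: mult_left_mono max_step_mono iterate_le_limit)
    then show "\<exists>N. \<forall>n\<ge>N. hitting_iterate (\<lambda>f x. \<delta> * max_step f x) A (Suc n) x
        \<le> \<delta> * one_step T ?v x" by blast
  qed
  obtain p where p: "p \<in> homogeneous_chains {T}"
    using homogeneous_chains_nonempty[OF transition[OF T]] by blast
  have "-1 * expectation_given p (hits A) [x] \<le> - (\<delta> ^ 0 * ?v x)" for x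
  proof (rule expectation_hits_le[where g = "\<lambda>n y. - (\<delta> ^ n * ?v y)" and B = "-1" and b = "\<lambda>n. - (\<delta> ^ n)",
        OF p transition[OF T]])
    have pow: "\<delta> ^ n * ?v y \<le> \<delta> ^ n" "\<delta> ^ n \<le> 1" for n y
      using \<delta> limit_bounds[of A y] by (auto intro: power_le_one mult_left_le)
    show lower: "-1 \<le> - (\<delta> ^ n * ?v y)" for n y
      using order_trans[OF pow] by simp
    show "-1 \<le> - (\<delta> ^ n * ?v y)" if "y \<in> A" for n y
      by (rule lower)
    show "- (\<delta> ^ n) \<le> - (\<delta> ^ n * ?v y)" for n y
      using pow by simp
    show "(\<lambda>n. - (\<delta> ^ n)) \<longlonglongrightarrow> 0"
      using \<delta> tendsto_minus[OF LIMSEQ_power_zero[of \<delta>]] by simp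
    show "one_step T (\<lambda>y. - (\<delta> ^ Suc n * ?v y)) x \<le> - (\<delta> ^ n * ?v x)" if "x \<notin> A" for n x
      using mult_left_mono[OF le[OF that], of "\<delta> ^ n"] \<delta>
      by (simp add: one_step_minus one_step_cmult mult_ac)
  qed
  moreover have "p \<in> homogeneous_chains \<T>"
    using p T by (auto simp: homogeneous_chains_def)
  ultimately show ?thesis by (intro bexI[of _ p]) auto
qed

text \<open>The horizon \<open>n\<close> is kept fixed while \<open>\<delta>\<close> tends to \<open>1\<close>, since the loss \<open>\<delta> ^ n\<close> is not uniform
  in \<open>n\<close>.\<close>

lemma max_limit_le_homogeneous:
  "ereal (hitting_limit max_step A x) \<le> upper_expectation (homogeneous_chains \<T>) (hits A) [x]"
    (is "_ \<le> ?H")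
proof -
  interpret monotone_averaging max_step by (rule max_averaging)
  have discounted: "ereal (\<delta> ^ n * hitting_iterate max_step A n x) \<le> ?H" if \<delta>: "0 \<le> \<delta>" "\<delta> < 1" for \<delta> n
  proof -
    interpret disc: monotone_averaging "\<lambda>f x. \<delta> * max_step f x"
      using \<delta> by (intro discounted_averaging) auto
    obtain p where p: "p \<in> homogeneous_chains \<T>"
      "hitting_limit (\<lambda>f x. \<delta> * max_step f x) A x \<le> expectation_given p (hits A) [x]"
      using homogeneous_chain_ge_discounted_limit[OF \<delta>] by blast
    have "\<delta> ^ n * hitting_iterate max_step A n x \<le> hitting_iterate (\<lambda>f x. \<delta> * max_step f x) A n x"
      using \<delta> by (intro power_mult_iterate_le) auto
    also have "\<dots> \<le> hitting_limit (\<lambda>f x. \<delta> * max_step f x) A x"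
      by (rule disc.iterate_le_limit)
    also note p(2)
    finally show ?thesis
      unfolding upper_expectation_def by (intro SUP_upper2[OF p(1)]) simp
  qed
  have "ereal (hitting_iterate max_step A n x) \<le> ?H" for n
  proof (rule LIMSEQ_le_const2)
    have "(\<lambda>k. 1 - inverse (real (Suc k))) \<longlonglongrightarrow> 1 - 0"
      by (intro tendsto_diff tendsto_const LIMSEQ_inverse_real_of_nat)
    then have "(\<lambda>k. (1 - inverse (real (Suc k))) ^ n * hitting_iterate max_step A n x)
        \<longlonglongrightarrow> (1 - 0) ^ n * hitting_iterate max_step A n x"
      by (intro tendsto_mult tendsto_power tendsto_const)
    then show "(\<lambda>k. ereal ((1 - inverse (real (Suc k))) ^ n * hitting_iterate max_step A n x))
        \<longlonglongrightarrow> ereal (hitting_iterate max_step A n x)"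
      by simp
    show "\<exists>N. \<forall>k\<ge>N. ereal ((1 - inverse (real (Suc k))) ^ n * hitting_iterate max_step A n x) \<le> ?H"
      by (intro exI[of _ 0] allI impI discounted) (auto simp: field_simps)
  qed
  moreover have "(\<lambda>n. ereal (hitting_iterate max_step A n x)) \<longlonglongrightarrow> ereal (hitting_limit max_step A x)"
    using iterate_tendsto by simp
  ultimately show ?thesis
    using LIMSEQ_le_const2 by blast
qed


section \<open>The lower hitting probability\<close>

lemma min_averaging: "monotone_averaging min_step"
  by standard (auto intro: min_step_mono simp: min_step_const)

text \<open>Stopping \<open>- l\<close> for the limit \<open>l\<close> would not do, as this may stay below \<open>0\<close> on paths that miss \<open>A\<close>.
  Letting the horizon run out at a time \<open>N\<close> makes the process vanish from then on.\<close>

lemma upper_V_minus_hits_le_min_limit: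
  "upper_V Q \<T> (\<lambda>\<omega>. - ereal (hits A \<omega>)) [x] \<le> - ereal (hitting_limit min_step A x)"
proof -
  interpret monotone_averaging min_step by (rule min_averaging)
  have "upper_V Q \<T> (\<lambda>\<omega>. ereal (-1 * hits A \<omega>)) [x] \<le> ereal (- hitting_iterate min_step A (N - 0) x)" for N
  proof (rule upper_V_hits_le[where g = "\<lambda>n y. - hitting_iterate min_step A (N - n) y"
        and B = "-1" and b = "\<lambda>n. if n < N then -1 else 0"])
    show "one_step T (\<lambda>y. - hitting_iterate min_step A (N - Suc n) y) x \<le> - hitting_iterate min_step A (N - n) x"
      if "T \<in> \<T>" "x \<notin> A" for T n x
    proof (cases "n < N")
      case True
      then have "N - n = Suc (N - Suc n)" by simp
      then show ?thesis
        using that min_step_le_one_step[OF that(1)] by (simp add: one_step_minus)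
    next
      case False
      then show ?thesis by (simp add: one_step_def)
    qed
    show "(\<lambda>n. if n < N then -1 else 0 :: real) \<longlonglongrightarrow> 0"
      by (rule tendsto_eventually) (rule eventually_sequentiallyI[of N], simp)
  qed (use iterate_bounds in \<open>auto simp: transition\<close>)
  then have "upper_V Q \<T> (\<lambda>\<omega>. - ereal (hits A \<omega>)) [x] \<le> ereal (- hitting_iterate min_step A N x)" for N
    by simp
  moreover have "(\<lambda>N. ereal (- hitting_iterate min_step A N x)) \<longlonglongrightarrow> ereal (- hitting_limit min_step A x)"
    using tendsto_minus[OF iterate_tendsto] by simp
  ultimately show ?thesis
    by (intro LIMSEQ_le_const[where X = "\<lambda>N. ereal (- hitting_iterate min_step A N x)"]) auto
qed

text \<open>The one-step minimum is continuous along the iteration: replacing \<open>l\<close> by its \<open>n\<close>-th iterate changes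
  every one-step average by at most the total error, which tends to \<open>0\<close>.\<close>

lemma one_step_min_limit_le:
  assumes "x \<notin> A"
  shows "one_step (greedy_matrix (\<lambda>y. - hitting_limit min_step A y)) (hitting_limit min_step A) x
    \<le> hitting_limit min_step A x"
proof -
  interpret monotone_averaging min_step by (rule min_averaging)
  let ?l = "hitting_limit min_step A"
  let ?i = "hitting_iterate min_step A"
  let ?e = "\<lambda>n. \<Sum>y\<in>UNIV. ?l y - ?i n y"
  have "one_step (greedy_matrix (\<lambda>y. - ?l y)) ?l x \<le> ?l x + ?e n" for n
  proof -
    let ?T = "greedy_matrix (\<lambda>y. - ?i n y)"
    have T: "transition_matrix ?T"
      by (intro transition greedy_matrix_in)
    have "one_step (greedy_matrix (\<lambda>y. - ?l y)) ?l x \<le> one_step ?T ?l x"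
      unfolding min_step_eq[symmetric] by (rule min_step_le_one_step[OF greedy_matrix_in])
    also have "\<dots> \<le> one_step ?T (\<lambda>y. ?i n y + ?e n) x"
    proof (rule one_step_mono[OF T])
      fix y
      have "?l y - ?i n y \<le> ?e n"
        by (rule member_le_sum) (use iterate_le_limit in auto)
      then show "?l y \<le> ?i n y + ?e n" by simp
    qed
    also have "\<dots> = one_step ?T (?i n) x + ?e n"
      using one_step_const[OF T, of "?e n" x]
      by (simp add: one_step_def distrib_left sum.distrib)
    also have "one_step ?T (?i n) x = ?i (Suc n) x"
      using assms by (simp add: min_step_eq)
    also have "\<dots> \<le> ?l x" by (rule iterate_le_limit)
    finally show ?thesis by simp
  qed
  moreover have "(\<lambda>n. ?l x + ?e n) \<longlonglongrightarrow> ?l x + (\<Sum>y\<in>UNIV. ?l y - ?l y)"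
    by (intro tendsto_intros iterate_tendsto)
  ultimately show ?thesis
    by (intro LIMSEQ_le_const[where X = "\<lambda>n. ?l x + ?e n"]) auto
qed

text \<open>In contrast to the maximising problem, delay can only help here, so a minimiser for the limit
  is optimal without discounting.\<close>

lemma homogeneous_chain_le_min_limit:
  "\<exists>p\<in>homogeneous_chains \<T>. \<forall>x. expectation_given p (hits A) [x] \<le> hitting_limit min_step A x"
proof -
  interpret monotone_averaging min_step by (rule min_averaging)
  let ?l = "hitting_limit min_step A"
  define T where "T = greedy_matrix (\<lambda>y. - ?l y)"
  have T: "T \<in> \<T>"
    unfolding T_def by (rule greedy_matrix_in)
  obtain p where p: "p \<in> homogeneous_chains {T}"
    using homogeneous_chains_nonempty[OF transition[OF T]] by blast
  have "1 * expectation_given p (hits A) [x] \<le> ?l x" for x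
    by (rule expectation_hits_le[where g = "\<lambda>_. ?l" and B = 0 and b = "\<lambda>_. 0", OF p transition[OF T]])
      (simp_all add: limit_bounds limit_hit one_step_min_limit_le T_def)
  moreover have "p \<in> homogeneous_chains \<T>"
    using p T by (auto simp: homogeneous_chains_def)
  ultimately show ?thesis by auto
qed

end


section \<open>Equality of the expectations\<close>

lemma homogeneous_subset_compatible: "homogeneous_chains \<T> \<subseteq> compatible_processes \<T>"
  unfolding homogeneous_chains_def compatible_processes_def by blast

lemma upper_expectation_compatible_le_upper_V:
  "upper_expectation (compatible_processes \<T>) (hits A) [x] \<le> upper_V Q \<T> (\<lambda>\<omega>. ereal (hits A \<omega>)) [x]"
  unfolding upper_expectation_def
  by (intro SUP_least expectation_le_upper_V[where C = 1] hits_measurable) (auto simp: hits_def)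

lemma lower_V_le_lower_expectation_compatible:
  "lower_V Q \<T> (\<lambda>\<omega>. ereal (hits A \<omega>)) [x] \<le> lower_expectation (compatible_processes \<T>) (hits A) [x]"
  unfolding lower_expectation_def lower_V_def
proof (rule INF_greatest)
  fix p assume p: "p \<in> compatible_processes \<T>"
  have "ereal (expectation_given p (\<lambda>\<omega>. - hits A \<omega>) [x]) \<le> upper_V Q \<T> (\<lambda>\<omega>. ereal (- hits A \<omega>)) [x]"
  proof (rule expectation_le_upper_V[OF p])
    show "(\<lambda>\<omega>. - hits A \<omega>) \<in> borel_measurable (path_measure p [x])"
      by (intro borel_measurable_uminus hits_measurable)
    show "\<bar>- hits A \<omega>\<bar> \<le> 1" for \<omega>
      by (simp add: hits_def)
  qed simp
  then show "- upper_V Q \<T> (\<lambda>\<omega>. - ereal (hits A \<omega>)) [x] \<le> ereal (expectation_given p (hits A) [x])"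
    by (simp add: expectation_given_def ereal_uminus_le_reorder)
qed

theorem theorem18:
  fixes A :: "'x::finite set"
    and \<T> :: "(real ^ 'x ^ 'x) set"
    and Q :: "('x \<Rightarrow> ereal) \<Rightarrow> ereal"
  assumes "\<T> \<noteq> {}"
    and "\<forall>T\<in>\<T>. transition_matrix T"
    and "closed \<T>"
    and "convex \<T>"
    and "separately_specified_rows \<T>"
    and "initial_upper_operator Q"
  shows "(\<exists>p\<in>homogeneous_chains \<T>. \<forall>x.
            lower_V Q \<T> (\<lambda>\<omega>. ereal (hits A \<omega>)) [x]
              = lower_expectation (compatible_processes \<T>) (hits A) [x]
          \<and> lower_expectation (compatible_processes \<T>) (hits A) [x]
              = lower_expectation (homogeneous_chains \<T>) (hits A) [x]
          \<and> lower_expectation (homogeneous_chains \<T>) (hits A) [x]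
              = ereal (expectation_given p (hits A) [x]))
       \<and> (\<forall>x.
            upper_V Q \<T> (\<lambda>\<omega>. ereal (hits A \<omega>)) [x]
              = upper_expectation (compatible_processes \<T>) (hits A) [x]
          \<and> upper_expectation (compatible_processes \<T>) (hits A) [x]
              = upper_expectation (homogeneous_chains \<T>) (hits A) [x])"
proof -
  interpret transition_family \<T>
    by standard (use assms in auto)
  obtain p where p: "p \<in> homogeneous_chains \<T>"
    and p_le: "\<And>x. expectation_given p (hits A) [x] \<le> hitting_limit min_step A x"
    using homogeneous_chain_le_min_limit[of A] by blast
  have lower: "lower_V Q \<T> (\<lambda>\<omega>. ereal (hits A \<omega>)) [x]
        = lower_expectation (compatible_processes \<T>) (hits A) [x]
      \<and> lower_expectation (compatible_processes \<T>) (hits A) [x]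
        = lower_expectation (homogeneous_chains \<T>) (hits A) [x]
      \<and> lower_expectation (homogeneous_chains \<T>) (hits A) [x]
        = ereal (expectation_given p (hits A) [x])" for x
  proof -
    have "lower_V Q \<T> (\<lambda>\<omega>. ereal (hits A \<omega>)) [x]
        \<le> lower_expectation (compatible_processes \<T>) (hits A) [x]"
      by (rule lower_V_le_lower_expectation_compatible)
    moreover have "lower_expectation (compatible_processes \<T>) (hits A) [x]
        \<le> lower_expectation (homogeneous_chains \<T>) (hits A) [x]"
      unfolding lower_expectation_def by (intro INF_superset_mono homogeneous_subset_compatible order_refl)
    moreover have "lower_expectation (homogeneous_chains \<T>) (hits A) [x]
        \<le> ereal (expectation_given p (hits A) [x])"
      unfolding lower_expectation_def by (rule INF_lower[OF p])
    moreover have "ereal (expectation_given p (hits A) [x]) \<le> ereal (hitting_limit min_step A x)"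
      using p_le by simp
    moreover have "ereal (hitting_limit min_step A x) \<le> lower_V Q \<T> (\<lambda>\<omega>. ereal (hits A \<omega>)) [x]"
      using upper_V_minus_hits_le_min_limit[of Q A x]
        ereal_minus_le_minus[of "- ereal (hitting_limit min_step A x)"]
      unfolding lower_V_def by (simp only: ereal_uminus_uminus)
    ultimately show ?thesis by (meson order.antisym order.trans)
  qed
  have upper: "upper_V Q \<T> (\<lambda>\<omega>. ereal (hits A \<omega>)) [x]
        = upper_expectation (compatible_processes \<T>) (hits A) [x]
      \<and> upper_expectation (compatible_processes \<T>) (hits A) [x]
        = upper_expectation (homogeneous_chains \<T>) (hits A) [x]" for x
  proof -
    \<comment> \<open>A cycle of inequalities, closed through the limit of the maximal probabilities.\<close>
    have "upper_expectation (homogeneous_chains \<T>) (hits A) [x]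
        \<le> upper_expectation (compatible_processes \<T>) (hits A) [x]"
      unfolding upper_expectation_def by (intro SUP_subset_mono homogeneous_subset_compatible order_refl)
    moreover have "upper_expectation (compatible_processes \<T>) (hits A) [x]
        \<le> upper_V Q \<T> (\<lambda>\<omega>. ereal (hits A \<omega>)) [x]"
      by (rule upper_expectation_compatible_le_upper_V)
    moreover have "upper_V Q \<T> (\<lambda>\<omega>. ereal (hits A \<omega>)) [x] \<le> ereal (hitting_limit max_step A x)"
      by (rule upper_V_le_max_limit)
    moreover have "ereal (hitting_limit max_step A x)
        \<le> upper_expectation (homogeneous_chains \<T>) (hits A) [x]"
      by (rule max_limit_le_homogeneous)
    ultimately show ?thesis by (meson order.antisym order.trans)
  qed
  show ?thesis using p lower upper by blast
qed

end
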